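(* Let $n\in\mathbb N$, let $\widehat{\mathcal G}_n=\mathcal C_n+\mathcal H_{n,1}$, and let $T_n=(t_{|k-j|})_{k,j=0}^{n-1}$ be a real symmetric Toeplitz matrix. Then there are $C_n(T_n)\in\mathcal C_n$ and $B_n(T_n)\in\mathcal B_n$ such that $C_n(T_n)+B_n(T_n)$ is the minimizer of $\|G-T_n\|_F$ over $G\in\widehat{\mathcal G}_n$ and also the minimizer of $\|G-T_n\|_F$ over $G\in\mathcal G_n$, where $C_n(T_n)=\mathrm{circ}(\mathbf c)$ with $$c_0=t_0,\qquad c_j=\frac{(n-j)\,t_j+j\,t_{n-j}}{n},\quad j\in\{1,2,\dots,n-1\},$$ and $B_n(T_n)=\mathrm{rcirc}(\mathbf b)$, with $\mathbf b$ given as follows. (i) For $n$ even and $j\in\{1,2,\dots,n-1\}\setminus\{n/2\}$: if $j$ is odd, $$b_j=\frac1{2n}\Bigl(\frac{4j-2n}{n}(t_j-t_{n-j})+4\sum_{k=0}^{(j-3)/2}\frac{2k+1}{n}(t_{2k+1}-t_{n-2k-1})+4\sum_{k=0}^{(n-j-3)/2}\frac{2k+1}{n}(t_{2k+1}-t_{n-2k-1})\Bigr);$$ if $j$ is even, $$b_j=\frac1{2n}\Bigl(\frac{4j-2n}{n}(t_j-t_{n-j})+4\sum_{k=1}^{j/2-1}\frac{2k}{n}(t_{2k}-t_{n-2k})+4\sum_{k=1}^{(n-j)/2-1}\frac{2k}{n}(t_{2k}-t_{n-2k})\Bigr).$$ (ii) For $n$ even, $$b_0=\frac2n\sum_{k=1}^{n/2-1}\frac{2k}{n}(t_{2k}-t_{n-2k}),\qquad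 b_{n/2}=\frac4n\sum_{k=1}^{n/4-1}\frac{2k}{n}(t_{2k}-t_{n-2k}).$$ (iii) For $n$ odd and $j\in\{1,2,\dots,n-1\}$: if $j$ is odd, $$b_j=\frac1{2n}\Bigl(\frac{4j-2n}{n}(t_j-t_{n-j})+4\sum_{k=0}^{(j-3)/2}\frac{2k+1}{n}(t_{2k+1}-t_{n-2k-1})+4\sum_{k=1}^{(n-j)/2-1}\frac{2k}{n}(t_{2k}-t_{n-2k})\Bigr);$$ if $j$ is even, $$b_j=\frac1{2n}\Bigl(\frac{4j-2n}{n}(t_j-t_{n-j})+4\sum_{k=1}^{j/2-1}\frac{2k}{n}(t_{2k}-t_{n-2k})+4\sum_{k=0}^{(n-j-3)/2}\frac{2k+1}{n}(t_{2k+1}-t_{n-2k-1})\Bigr).$$ (iv) For $n$ odd, $$b_0=\frac2n\sum_{k=0}^{(n-3)/2}\frac{2k+1}{n}(t_{2k+1}-t_{n-2k-1}).$$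
   Context: Rows, columns and vector components are indexed by $0,1,\dots,n-1$; $\|\cdot\|_F$ is the Frobenius norm; empty sums are $0$. $Q_n$ is the real $n\times n$ matrix whose columns $\mathbf q^{(0)},\dots,\mathbf q^{(n-1)}$ are as follows: $\mathbf q^{(0)}=\frac1{\sqrt n}(1,\dots,1)^T$; for $1\le j\le\lfloor\frac{n-1}2\rfloor$, $\mathbf q^{(j)}$ has $k$-th entry $\sqrt{2/n}\,\cos(2\pi kj/n)$ and $\mathbf q^{(n-j)}$ has $k$-th entry $\sqrt{2/n}\,\sin(2\pi kj/n)$, $k=0,\dots,n-1$; if $n$ is even, $\mathbf q^{(n/2)}$ has $k$-th entry $(-1)^k/\sqrt n$. ($Q_n$ is orthogonal.) A vector $\mathbf x\in\mathbb R^n$ is symmetric (resp. asymmetric) if $x_j=x_{(n-j)\bmod n}$ (resp. $x_j=-x_{(n-j)\bmod n}$) for all $j$. $\mathcal G_n=\{Q_n\,\mathrm{diag}(\boldsymbol\lambda)Q_n^T:\boldsymbol\lambda\in\mathbb R^n\}$; $\mathcal C_n$ (resp. $\mathcal B_n$) is the subset with $\boldsymbol\lambda$ symmetric (resp. asymmetric). For $\mathbf a\in\mathbb R^n$, $\mathrm{circ}(\mathbf a)$ is the matrix with $(k,l)$ entry $a_{(l-k)\bmod n}$, and $\mathrm{rcirc}(\mathbf a)$ the matrix with $(k,l)$ entry $a_{(k+l)\bmod n}$. $\mathcal H_{n,1}=\{\mathrm{rcirc}(\mathbf a):\mathbf a\in\mathbb R^n\text{ symmetric}\}$.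
   Formalization: For n ≡ 2 (mod 4) the limit n/4−1 in b_{n/2} is not an integer, and rounding it makes the claim false (n=6, t_1=1, other t_j=0); there b_{n/2} = (4/n)Σ_{k=0}^{(n/2−3)/2} ((2k+1)/n)(t_{2k+1}−t_{n−2k−1}) is used, the odd-j formula of (i) at j=n/2. *)

theory Defs
  imports Complex_Main "Jordan_Normal_Form.Matrix"
begin

definition frobenius_norm :: "real mat \<Rightarrow> real" where
  "frobenius_norm A = sqrt (\<Sum>i<dim_row A. \<Sum>j<dim_col A. (A $$ (i, j))\<^sup>2)"

(* Columns beyond (n-1) div 2, apart from the middle one for even n, are the sine columns
   q^(n-i) with i = n - j. *)
definition Q_mat :: "nat \<Rightarrow> real mat" where
  "Q_mat n = mat n n (\<lambda>(k, j).
     if j = 0 then 1 / sqrt (real n)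
     else if j \<le> (n - 1) div 2 then sqrt (2 / real n) * cos (2 * pi * real k * real j / real n)
     else if even n \<and> j = n div 2 then (-1) ^ k / sqrt (real n)
     else sqrt (2 / real n) * sin (2 * pi * real k * real (n - j) / real n))"

definition symmetric_vec :: "nat \<Rightarrow> real vec \<Rightarrow> bool" where
  "symmetric_vec n x \<longleftrightarrow> x \<in> carrier_vec n \<and> (\<forall>j<n. x $ j = x $ ((n - j) mod n))"

definition asymmetric_vec :: "nat \<Rightarrow> real vec \<Rightarrow> bool" where
  "asymmetric_vec n x \<longleftrightarrow> x \<in> carrier_vec n \<and> (\<forall>j<n. x $ j = - (x $ ((n - j) mod n)))"

definition Q_conj_diag :: "nat \<Rightarrow> real vec \<Rightarrow> real mat" where
  "Q_conj_diag n l = Q_mat n * mat_diag n (\<lambda>i. l $ i) * transpose_mat (Q_mat n)"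

definition G_set :: "nat \<Rightarrow> real mat set" where
  "G_set n = {Q_conj_diag n l | l. l \<in> carrier_vec n}"

definition C_set :: "nat \<Rightarrow> real mat set" where
  "C_set n = {Q_conj_diag n l | l. symmetric_vec n l}"

definition B_set :: "nat \<Rightarrow> real mat set" where
  "B_set n = {Q_conj_diag n l | l. asymmetric_vec n l}"

definition circ :: "nat \<Rightarrow> real vec \<Rightarrow> real mat" where
  "circ n a = mat n n (\<lambda>(k, l). a $ nat ((int l - int k) mod int n))"

definition rcirc :: "nat \<Rightarrow> real vec \<Rightarrow> real mat" where
  "rcirc n a = mat n n (\<lambda>(k, l). a $ ((k + l) mod n))"

definition H1_set :: "nat \<Rightarrow> real mat set" where
  "H1_set n = {rcirc n a | a. symmetric_vec n a}"

definition G_hat_set :: "nat \<Rightarrow> real mat set" where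
  "G_hat_set n = {C + H | C H. C \<in> C_set n \<and> H \<in> H1_set n}"

definition sym_toeplitz :: "nat \<Rightarrow> (nat \<Rightarrow> real) \<Rightarrow> real mat" where
  "sym_toeplitz n t = mat n n (\<lambda>(k, j). t (nat \<bar>int k - int j\<bar>))"

definition the_minimizer :: "('a \<Rightarrow> real) \<Rightarrow> 'a set \<Rightarrow> 'a \<Rightarrow> bool" where
  "the_minimizer f S x \<longleftrightarrow>
     is_arg_min f (\<lambda>y. y \<in> S) x \<and> (\<forall>y. is_arg_min f (\<lambda>y. y \<in> S) y \<longrightarrow> y = x)"

(* The bound m is exclusive: a sum written with inclusive upper limit u is taken at m = u + 1.
   In this form the empty sums (u = -1 for odd_sum, u = 0 for even_sum) are not affected by
   truncated subtraction. *)
definition odd_sum :: "nat \<Rightarrow> (nat \<Rightarrow> real) \<Rightarrow> nat \<Rightarrow> real" where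
  "odd_sum n t m =
     (\<Sum>k = 0..<m. real (2 * k + 1) / real n * (t (2 * k + 1) - t (n - 2 * k - 1)))"

definition even_sum :: "nat \<Rightarrow> (nat \<Rightarrow> real) \<Rightarrow> nat \<Rightarrow> real" where
  "even_sum n t m =
     (\<Sum>k = 1..<m. real (2 * k) / real n * (t (2 * k) - t (n - 2 * k)))"

definition c_coeffs :: "nat \<Rightarrow> (nat \<Rightarrow> real) \<Rightarrow> real vec" where
  "c_coeffs n t = vec n (\<lambda>j.
     if j = 0 then t 0
     else (real (n - j) * t j + real j * t (n - j)) / real n)"

(* For even n the middle sum with upper limit n/4 - 1 requires 4 dvd n. If n = 2 (mod 4), the
   index n/2 is odd, and the middle entry is given by the general formula for odd j at
   j = n/2: its leading term vanishes, and both sums run over 0 \<le> k \<le> (n/2 - 3)/2, i.e.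
   k < n div 4. Rounding n/4 - 1 down in the sum over even indices instead would give a
   matrix outside B_set n (e.g. n = 6, t 1 = 1, all other t j = 0). *)
definition b_coeffs :: "nat \<Rightarrow> (nat \<Rightarrow> real) \<Rightarrow> real vec" where
  "b_coeffs n t = vec n (\<lambda>j.
     let lead = (4 * real j - 2 * real n) / real n * (t j - t (n - j)) in
     if even n then
       (if j = 0 then 2 / real n * even_sum n t (n div 2)
        else if j = n div 2 then
          (if 4 dvd n then 4 / real n * even_sum n t (n div 4)
           else 4 / real n * odd_sum n t (n div 4))
        else if odd j then
          1 / (2 * real n) *
            (lead + 4 * odd_sum n t ((j - 1) div 2) + 4 * odd_sum n t ((n - j - 1) div 2))
        else
          1 / (2 * real n) *
            (lead + 4 * even_sum n t (j div 2) + 4 * even_sum n t ((n - j) div 2)))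
     else
       (if j = 0 then 2 / real n * odd_sum n t ((n - 1) div 2)
        else if odd j then
          1 / (2 * real n) *
            (lead + 4 * odd_sum n t ((j - 1) div 2) + 4 * even_sum n t ((n - j) div 2))
        else
          1 / (2 * real n) *
            (lead + 4 * even_sum n t (j div 2) + 4 * odd_sum n t ((n - j - 1) div 2))))"

end

theory Submission
  imports Defs
begin

text \<open>
  With eigenvalues split into symmetric and asymmetric parts, the addition theorems turn
  \<open>Q diag(l) Q\<^sup>T\<close> into a symmetric circulant plus a reverse circulant, both given by cosine sums;
  the two parts are orthogonal for the Frobenius inner product. The circulant projection of the
  Toeplitz matrix of \<open>t\<close> averages along cyclic diagonals, and what remains is the Toeplitz matrix
  of \<open>d\<^sub>j = (j/n) (t\<^sub>j - t\<^sub>n\<^sub>-\<^sub>j)\<close>. Averaging this residue over pairs of antidiagonals \<open>m\<close> and \<open>n - m\<close> gives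
  exactly the vector \<open>b\<close>, whatever the parities of \<open>n\<close> and \<open>j\<close>. Hence the difference between the
  Toeplitz matrix and the claimed minimizer is orthogonal to all symmetric circulants and all
  symmetric reverse circulants, and Pythagoras applies to both sets.
\<close>

section \<open>Discrete cosine sums\<close>

text \<open>Up to normalisation this is the cosine transform: on symmetric vectors,
  \<open>cos_sum\<close> and \<open>n * cos_sum\<close> invert each other. The integer argument
  admits negative index differences.\<close>

definition cos_sum :: "nat \<Rightarrow> real vec \<Rightarrow> int \<Rightarrow> real" where
  "cos_sum n u m = (\<Sum>j<n. u $ j * cos (2 * pi * real_of_int m * real j / real n)) / real n"

lemma cos_periodic_int:
  assumes "n > 0"
  shows "cos (2 * pi * real_of_int (m + int n * q) * real j / real n)
       = cos (2 * pi * real_of_int m * real j / real n)"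
proof -
  have "2 * pi * real_of_int (m + int n * q) * real j / real n
      = 2 * pi * real_of_int m * real j / real n + 2 * pi * real_of_int (q * int j)"
    using assms by (simp add: field_simps)
  then show ?thesis
    using cos_int_2pin[of "q * int j"] sin_int_2pin[of "q * int j"]
    by (simp only: cos_add)
qed

lemma cos_sum_mod:
  assumes "n > 0"
  shows "cos_sum n u (m mod int n) = cos_sum n u m"
proof -
  have "m = m mod int n + int n * (m div int n)" by simp
  then have "cos (2 * pi * real_of_int m * real j / real n)
      = cos (2 * pi * real_of_int (m mod int n) * real j / real n)" for j
    using cos_periodic_int[OF assms, of "m mod int n" "m div int n" j] by metis
  then show ?thesis unfolding cos_sum_def by presburger
qed

lemma cos_sum_uminus: "cos_sum n u (- m) = cos_sum n u m"
  unfolding cos_sum_def by simp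

text \<open>Multiplying by \<open>2 * sin x\<close> with \<open>x = pi * d / n\<close> makes the sum
  telescope to two sines whose arguments differ by \<open>2 * pi * d\<close>; \<open>sin x\<close>
  is nonzero because \<open>n\<close> does not divide \<open>d\<close>. The phase \<open>p\<close>
  later absorbs the other index of a double sum.\<close>

lemma sum_cos_eq_0:
  fixes d :: int
  assumes n: "n > 0" and nd: "\<not> int n dvd d"
  shows "(\<Sum>k<n. cos (2 * pi * real_of_int d * real k / real n + p)) = 0"
proof -
  define x where "x = pi * real_of_int d / real n"
  have sx: "sin x \<noteq> 0"
  proof
    assume "sin x = 0"
    then obtain i :: int where "x = of_int i * pi"
      by (auto simp: sin_zero_iff_int2)
    then have "real_of_int d = of_int i * real n"
      using n by (simp add: x_def field_simps)
    then have "d = i * int n"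
      by (metis of_int_eq_iff of_int_mult of_int_of_nat_eq)
    with nd show False by simp
  qed
  have tele: "2 * sin x * (\<Sum>k<N. cos (2 * x * real k + p))
      = sin (2 * x * real N - x + p) - sin (p - x)" for N
  proof (induction N)
    case (Suc N)
    have "2 * sin x * cos (2 * x * real N + p)
        = sin (2 * x * real (Suc N) - x + p) - sin (2 * x * real N - x + p)"
    proof -
      have "2 * x * real (Suc N) - x + p = (2 * x * real N + p) + x"
           "2 * x * real N - x + p = (2 * x * real N + p) - x"
        by (simp_all add: algebra_simps)
      then show ?thesis by (simp only: sin_add sin_diff) simp
    qed
    with Suc show ?case by (simp add: algebra_simps)
  qed (simp add: algebra_simps)
  have "2 * x * real n - x + p = (p - x) + 2 * pi * real_of_int d"
    using n by (simp add: x_def field_simps)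
  then have "sin (2 * x * real n - x + p) = sin (p - x)"
    using cos_int_2pin[of d] sin_int_2pin[of d] by (simp only: sin_add)
  with tele[of n] sx have "(\<Sum>k<n. cos (2 * x * real k + p)) = 0" by simp
  then show ?thesis by (simp add: x_def mult.assoc)
qed

lemma sum_cos_orthogonal:
  fixes d :: int
  assumes n: "n > 0"
  shows "(\<Sum>k<n. cos (2 * pi * real_of_int d * real k / real n)) = (if int n dvd d then real n else 0)"
proof (cases "int n dvd d")
  case True
  then obtain q where q: "d = 0 + int n * q" by auto
  have "cos (2 * pi * real_of_int d * real k / real n) = 1" for k
    unfolding q using cos_periodic_int[OF n, of 0 q k] by simp
  then show ?thesis using True by simp
next
  case False
  then show ?thesis using sum_cos_eq_0[OF n False, of 0] by simp
qed

lemma bij_betw_neg_mod: "bij_betw (\<lambda>j. (n - j) mod n) {..<n} {..<n::nat}"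
proof -
  have inv: "(n - (n - j) mod n) mod n = j" if "j < n" for j
    using that by (cases "j = 0") auto
  show ?thesis
    by (rule bij_betwI[where g = "\<lambda>j. (n - j) mod n"]) (auto simp: inv)
qed

lemma sum_neg_mod: "(\<Sum>j<n. f ((n - j) mod n)) = (\<Sum>j<(n::nat). f j)"
  by (rule sum.reindex_bij_betw[OF bij_betw_neg_mod])

text \<open>Pairs each index with its mirror image, self-paired indices included, so that symmetry
  can be exploited without cutting the range at \<open>n/2\<close>.\<close>

lemma sum_symmetrize:
  fixes f :: "nat \<Rightarrow> real"
  shows "(\<Sum>j<n. f j) = (\<Sum>j<n. (f j + f ((n - j) mod n)) / 2)"
proof -
  have "(\<Sum>j<n. (f j + f ((n - j) mod n)) / 2) = ((\<Sum>j<n. f j) + (\<Sum>j<n. f ((n - j) mod n))) / 2"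
    by (simp add: sum.distrib flip: sum_divide_distrib)
  then show ?thesis by (simp add: sum_neg_mod)
qed

lemma symmetric_vecD: "symmetric_vec n a \<Longrightarrow> j < n \<Longrightarrow> a $ ((n - j) mod n) = a $ j"
  unfolding symmetric_vec_def by metis

lemma asymmetric_vecD: "asymmetric_vec n a \<Longrightarrow> j < n \<Longrightarrow> a $ ((n - j) mod n) = - a $ j"
  unfolding asymmetric_vec_def by (metis minus_minus)

text \<open>The product formula and orthogonality turn the inner sum into two half-weight deltas, at
  \<open>m\<close> and at its mirror index. Symmetry of \<open>a\<close> lets the halves add up to
  \<open>a $ m\<close>, also when \<open>m\<close> is its own mirror.\<close>

lemma cos_sum_inverse:
  assumes n: "n > 0" and a: "symmetric_vec n a" and m: "m < n"
  shows "cos_sum n (vec n (\<lambda>j. real n * cos_sum n a (int j))) (int m) = a $ m"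
proof -
  define c where "c x j = cos (2 * pi * real_of_int x * real j / real n)" for x :: int and j :: nat
  have prod: "c x j * c y j = (c (x - y) j + c (x + y) j) / 2" for x y j
  proof -
    have "2 * pi * real_of_int (x - y) * real j / real n
        = 2 * pi * real_of_int x * real j / real n - 2 * pi * real_of_int y * real j / real n"
      "2 * pi * real_of_int (x + y) * real j / real n
        = 2 * pi * real_of_int x * real j / real n + 2 * pi * real_of_int y * real j / real n"
      by (simp_all add: algebra_simps diff_divide_distrib add_divide_distrib)
    then show ?thesis unfolding c_def by (simp only: cos_add cos_diff) simp
  qed
  have split: "x * (((if P then r else 0) + (if Q then r else 0)) / 2)
      = (if P then r / 2 * x else 0) + (if Q then r / 2 * x else 0)" for x r :: real and P Q
    by (simp add: field_simps)
  have orth: "(\<Sum>j<n. c x j) = (if int n dvd x then real n else 0)" for x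
    unfolding c_def by (rule sum_cos_orthogonal[OF n])
  have sw: "cos (2 * pi * real_of_int (int j) * real k / real n) = c (int k) j" for j k
    unfolding c_def by (rule arg_cong[where f = cos]) (simp only: of_int_of_nat_eq mult.assoc mult.commute[of "real k"])
  have inner: "real n * cos_sum n a (int j) = (\<Sum>k<n. a $ k * c (int k) j)" for j
    unfolding cos_sum_def sw using n by simp
  have "cos_sum n (vec n (\<lambda>j. real n * cos_sum n a (int j))) (int m)
      = (\<Sum>j<n. (\<Sum>k<n. a $ k * c (int k) j) * c (int m) j) / real n"
    unfolding inner cos_sum_def[of n "vec n F" for F] c_def[symmetric] by simp
  also have "(\<Sum>j<n. (\<Sum>k<n. a $ k * c (int k) j) * c (int m) j)
      = (\<Sum>k<n. a $ k * (\<Sum>j<n. c (int k) j * c (int m) j))"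
    by (simp add: sum_distrib_left sum_distrib_right mult.assoc) (rule sum.swap)
  also have "\<dots> = (\<Sum>k<n. a $ k * (((if int n dvd int k - int m then real n else 0)
                    + (if int n dvd int k + int m then real n else 0)) / 2))"
    by (simp only: prod sum.distrib orth flip: sum_divide_distrib)
  also have "\<dots> = (\<Sum>k<n. (if k = m then real n / 2 * a $ k else 0)
                    + (if k = (n - m) mod n then real n / 2 * a $ k else 0))"
  proof (rule sum.cong[OF refl])
    fix k assume "k \<in> {..<n}"
    then have k: "k < n" by simp
    have 1: "int n dvd int k - int m \<longleftrightarrow> k = m"
      using k m by (simp flip: mod_eq_dvd_iff)
    have 2: "int n dvd int k + int m \<longleftrightarrow> k = (n - m) mod n"
    proof -
      have "int n dvd int k + int m \<longleftrightarrow> n dvd k + m" by (metis int_dvd_int_iff of_nat_add)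
      also have "\<dots> \<longleftrightarrow> k + m = 0 \<or> k + m = n"
      proof
        assume "n dvd k + m"
        then obtain q where q: "k + m = n * q" by auto
        with k m have "n * q < n * 2" by linarith
        then have "q < 2" by simp
        then have "q = 0 \<or> q = 1" by auto
        with q show "k + m = 0 \<or> k + m = n" by auto
      qed auto
      also have "\<dots> \<longleftrightarrow> k = (n - m) mod n"
        using k m by (cases "m = 0") auto
      finally show ?thesis .
    qed
    show "a $ k * (((if int n dvd int k - int m then real n else 0)
                    + (if int n dvd int k + int m then real n else 0)) / 2)
       = (if k = m then real n / 2 * a $ k else 0)
                    + (if k = (n - m) mod n then real n / 2 * a $ k else 0)"
      unfolding 1 2 by (rule split)
  qed
  also have "\<dots> = real n / 2 * a $ m + real n / 2 * a $ ((n - m) mod n)"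
  proof -
    have "(\<Sum>k<n. if k = i then real n / 2 * a $ k else 0) = real n / 2 * a $ i" if "i < n" for i
      using that by simp
    from this[OF m] this[of "(n - m) mod n"] n show ?thesis
      unfolding sum.distrib by simp
  qed
  also have "\<dots> = real n * a $ m"
    using symmetric_vecD[OF a m] by simp
  finally show ?thesis using n by simp
qed

text \<open>\<open>cos_sum\<close> is even and \<open>n\<close>-periodic in its integer argument,
  whatever \<open>a\<close> is. The factor \<open>s\<close> covers both uses: \<open>1\<close> for
  matrix entries, \<open>n\<close> for eigenvalues.\<close>

lemma symmetric_cos_sum:
  assumes n: "n > 0"
  shows "symmetric_vec n (vec n (\<lambda>j. s * cos_sum n a (int j)))"
  unfolding symmetric_vec_def
proof (intro conjI allI impI)
  fix j assume j: "j < n"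
  have "int ((n - j) mod n) = (int n - int j) mod int n"
    using j by (simp only: of_nat_mod of_nat_diff less_imp_le)
  also have "\<dots> = (- int j) mod int n"
    by (metis add_uminus_conv_diff mod_add_self1)
  finally have "cos_sum n a (int ((n - j) mod n)) = cos_sum n a (int j)"
    using cos_sum_mod[OF n] cos_sum_uminus by metis
  then show "vec n (\<lambda>j. s * cos_sum n a (int j)) $ j = vec n (\<lambda>j. s * cos_sum n a (int j)) $ ((n - j) mod n)"
    using j by simp
qed simp

section \<open>Matrices diagonalised by the real Fourier matrix\<close>

lemma Q_mat_carrier: "Q_mat n \<in> carrier_mat n n"
  unfolding Q_mat_def by (rule mat_carrier)

lemma Q_conj_diag_carrier: "Q_conj_diag n l \<in> carrier_mat n n"
  unfolding Q_conj_diag_def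
  by (rule mult_carrier_mat[OF mult_carrier_mat[OF Q_mat_carrier mat_diag_dim]])
    (simp add: Q_mat_carrier)

lemma Q_conj_diag_entry:
  assumes "k < n" "m < n"
  shows "Q_conj_diag n l $$ (k, m) = (\<Sum>j<n. l $ j * (Q_mat n $$ (k, j) * Q_mat n $$ (m, j)))"
proof -
  have Q: "Q_mat n \<in> carrier_mat n n" by (rule Q_mat_carrier)
  have "Q_mat n * mat_diag n (\<lambda>i. l $ i) = mat n n (\<lambda>(i, j). Q_mat n $$ (i, j) * l $ j)"
    by (rule mat_diag_mult_right[OF Q])
  then show ?thesis
    unfolding Q_conj_diag_def using assms Q
    by (auto simp: scalar_prod_def atLeast0LessThan intro!: sum.cong)
qed

lemma cos_reflect:
  assumes "n > 0" "j \<le> n"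
  shows "cos (2 * pi * real_of_int m * real (n - j) / real n) = cos (2 * pi * real_of_int m * real j / real n)"
proof -
  have "2 * pi * real_of_int m * real (n - j) / real n
      = 2 * pi * real_of_int m - 2 * pi * real_of_int m * real j / real n"
    using assms by (simp add: of_nat_diff field_simps)
  then show ?thesis
    using cos_int_2pin[of m] sin_int_2pin[of m] by (simp only: cos_diff)
qed

text \<open>\<^term>\<open>n - j\<close> is the sine partner of the cosine column \<^term>\<open>j\<close>; the columns \<^term>\<open>0::nat\<close> and
  \<open>n/2\<close> are their own partners, which kills asymmetric eigenvalues there.\<close>

definition refl_sign :: "nat \<Rightarrow> nat \<Rightarrow> real" where
  "refl_sign n j = (if j = 0 \<or> 2 * j = n then 0 else if 2 * j < n then 1 else - 1)"

lemma refl_sign_reflect: "j < n \<Longrightarrow> refl_sign n ((n - j) mod n) = - refl_sign n j"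
  by (cases "j = 0") (auto simp: refl_sign_def)

text \<open>Columns \<open>j\<close> and \<open>n - j\<close> carry the cosine and the sine of the
  same frequency, so the addition theorems merge the pair into a function of \<open>k - m\<close> or
  of \<open>k + m\<close>.\<close>

lemma Q_pair_low:
  assumes "0 < j" "2 * j < n" "k < n" "m < n"
  shows "Q_mat n $$ (k, j) * Q_mat n $$ (m, j) + Q_mat n $$ (k, n - j) * Q_mat n $$ (m, n - j)
           = 2 / real n * cos (2 * pi * real_of_int (int k - int m) * real j / real n)"
    and "Q_mat n $$ (k, j) * Q_mat n $$ (m, j) - Q_mat n $$ (k, n - j) * Q_mat n $$ (m, n - j)
           = 2 / real n * cos (2 * pi * real_of_int (int k + int m) * real j / real n)"
proof -
  have c: "Q_mat n $$ (x, j) = sqrt (2 / real n) * cos (2 * pi * real x * real j / real n)"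
    and s: "Q_mat n $$ (x, n - j) = sqrt (2 / real n) * sin (2 * pi * real x * real j / real n)"
    if "x < n" for x
    using that assms by (auto simp: Q_mat_def)
  have sq: "sqrt (2 / real n) * u * (sqrt (2 / real n) * v) = 2 / real n * (u * v)" for u v
    by (metis (no_types, opaque_lifting) divide_nonneg_nonneg mult.assoc mult.left_commute
        of_nat_0_le_iff real_sqrt_mult_self abs_of_nonneg zero_le_numeral)
  have args: "2 * pi * real_of_int (int k - int m) * real j / real n
      = 2 * pi * real k * real j / real n - 2 * pi * real m * real j / real n"
    "2 * pi * real_of_int (int k + int m) * real j / real n
      = 2 * pi * real k * real j / real n + 2 * pi * real m * real j / real n"
    by (simp_all add: algebra_simps diff_divide_distrib add_divide_distrib)
  show "Q_mat n $$ (k, j) * Q_mat n $$ (m, j) + Q_mat n $$ (k, n - j) * Q_mat n $$ (m, n - j)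
           = 2 / real n * cos (2 * pi * real_of_int (int k - int m) * real j / real n)"
    unfolding args c[OF assms(3)] c[OF assms(4)] s[OF assms(3)] s[OF assms(4)] sq cos_diff
    by (simp add: distrib_left)
  show "Q_mat n $$ (k, j) * Q_mat n $$ (m, j) - Q_mat n $$ (k, n - j) * Q_mat n $$ (m, n - j)
           = 2 / real n * cos (2 * pi * real_of_int (int k + int m) * real j / real n)"
    unfolding args c[OF assms(3)] c[OF assms(4)] s[OF assms(3)] s[OF assms(4)] sq cos_add
    by (simp add: right_diff_distrib)
qed

text \<open>Extends the pairing to all columns. A self-paired column is counted twice in the sum and
  cancels in the difference, where \<open>refl_sign\<close> is zero; above the middle, cosine and
  sine swap roles, which only flips the sign of the difference.\<close>

lemma Q_pair:
  assumes j: "j < n" and km: "k < n" "m < n"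
  defines "j' \<equiv> (n - j) mod n"
  shows "Q_mat n $$ (k, j) * Q_mat n $$ (m, j) + Q_mat n $$ (k, j') * Q_mat n $$ (m, j')
           = 2 / real n * cos (2 * pi * real_of_int (int k - int m) * real j / real n)" (is ?plus)
    and "Q_mat n $$ (k, j) * Q_mat n $$ (m, j) - Q_mat n $$ (k, j') * Q_mat n $$ (m, j')
           = refl_sign n j * (2 / real n * cos (2 * pi * real_of_int (int k + int m) * real j / real n))"
      (is ?minus)
proof -
  consider "j = 0" | "2 * j = n" "0 < j" | "0 < j" "2 * j < n" | "n < 2 * j" by linarith
  then have "?plus \<and> ?minus"
  proof cases
    case 1
    with j km show ?thesis by (simp add: j'_def Q_mat_def refl_sign_def)
  next
    case 2
    have j': "j' = j" using 2 by (auto simp: j'_def)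
    have Qx: "Q_mat n $$ (x, j) = (-1) ^ x / sqrt (real n)" if "x < n" for x
      using that 2 j by (auto simp: Q_mat_def)
    have arg: "2 * pi * real_of_int (int k - int m) * real j / real n = pi * real k - pi * real m"
      using 2 by (simp add: field_simps flip: 2(1))
    have "cos (pi * real k - pi * real m) = (-1) ^ k * (-1) ^ m"
      by (simp add: cos_diff mult.commute[of pi] cos_npi sin_npi)
    then show ?thesis
      unfolding arg using km 2 by (simp add: j' Qx refl_sign_def)
  next
    case 3
    then have "j' = n - j" using j by (simp add: j'_def)
    with Q_pair_low[OF 3 km] 3 show ?thesis by (simp add: refl_sign_def)
  next
    case 4
    then have j': "j' = n - j" "n - j' = j" "0 < j'" "2 * j' < n" using j by (auto simp: j'_def)
    have "n > 0" "j \<le> n" using j by auto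
    note cr = cos_reflect[OF this]
    show ?thesis
      using Q_pair_low[OF j'(3,4) km] 4 j unfolding j'(1) cr
      by (simp add: refl_sign_def)
  qed
  then show ?plus ?minus by auto
qed

text \<open>Paired columns share an eigenvalue, so only sums of column products occur and the entry
  depends on \<open>k - m\<close> alone.\<close>

lemma Q_conj_diag_symmetric_entry:
  assumes l: "symmetric_vec n l" and km: "k < n" "m < n"
  shows "Q_conj_diag n l $$ (k, m) = cos_sum n l (int k - int m)"
proof -
  have "Q_conj_diag n l $$ (k, m) = (\<Sum>j<n. l $ j * (Q_mat n $$ (k, j) * Q_mat n $$ (m, j)))"
    by (rule Q_conj_diag_entry[OF km])
  also have "\<dots> = (\<Sum>j<n. (l $ j * (Q_mat n $$ (k, j) * Q_mat n $$ (m, j)) +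
       l $ ((n - j) mod n) * (Q_mat n $$ (k, (n - j) mod n) * Q_mat n $$ (m, (n - j) mod n))) / 2)"
    by (rule sum_symmetrize)
  also have "\<dots> = (\<Sum>j<n. l $ j * cos (2 * pi * real_of_int (int k - int m) * real j / real n) / real n)"
  proof (rule sum.cong[OF refl])
    fix j assume "j \<in> {..<n}"
    then have j: "j < n" by simp
    then have lj: "l $ ((n - j) mod n) = l $ j" by (rule symmetric_vecD[OF l])
    show "(l $ j * (Q_mat n $$ (k, j) * Q_mat n $$ (m, j)) +
       l $ ((n - j) mod n) * (Q_mat n $$ (k, (n - j) mod n) * Q_mat n $$ (m, (n - j) mod n))) / 2
      = l $ j * cos (2 * pi * real_of_int (int k - int m) * real j / real n) / real n"
      unfolding lj distrib_left[symmetric] Q_pair(1)[OF j km] by simp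
  qed
  finally show ?thesis by (simp add: cos_sum_def sum_divide_distrib)
qed

text \<open>Paired columns have opposite eigenvalues, so only differences of column products occur
  and the entry depends on \<open>k + m\<close> alone.\<close>

lemma Q_conj_diag_asymmetric_entry:
  assumes l: "asymmetric_vec n l" and km: "k < n" "m < n"
  shows "Q_conj_diag n l $$ (k, m) = cos_sum n (vec n (\<lambda>j. refl_sign n j * l $ j)) (int k + int m)"
proof -
  have "Q_conj_diag n l $$ (k, m) = (\<Sum>j<n. l $ j * (Q_mat n $$ (k, j) * Q_mat n $$ (m, j)))"
    by (rule Q_conj_diag_entry[OF km])
  also have "\<dots> = (\<Sum>j<n. (l $ j * (Q_mat n $$ (k, j) * Q_mat n $$ (m, j)) +
       l $ ((n - j) mod n) * (Q_mat n $$ (k, (n - j) mod n) * Q_mat n $$ (m, (n - j) mod n))) / 2)"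
    by (rule sum_symmetrize)
  also have "\<dots> = (\<Sum>j<n. refl_sign n j * l $ j * cos (2 * pi * real_of_int (int k + int m) * real j / real n) / real n)"
  proof (rule sum.cong[OF refl])
    fix j assume "j \<in> {..<n}"
    then have j: "j < n" by simp
    then have lj: "l $ ((n - j) mod n) = - l $ j" by (rule asymmetric_vecD[OF l])
    have "(l $ j * (Q_mat n $$ (k, j) * Q_mat n $$ (m, j)) +
       l $ ((n - j) mod n) * (Q_mat n $$ (k, (n - j) mod n) * Q_mat n $$ (m, (n - j) mod n))) / 2
      = l $ j * (Q_mat n $$ (k, j) * Q_mat n $$ (m, j) -
        Q_mat n $$ (k, (n - j) mod n) * Q_mat n $$ (m, (n - j) mod n)) / 2"
      unfolding lj by (simp add: right_diff_distrib)
    also have "\<dots> = refl_sign n j * l $ j * cos (2 * pi * real_of_int (int k + int m) * real j / real n) / real n"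
      unfolding Q_pair(2)[OF j km] by simp
    finally show "(l $ j * (Q_mat n $$ (k, j) * Q_mat n $$ (m, j)) +
       l $ ((n - j) mod n) * (Q_mat n $$ (k, (n - j) mod n) * Q_mat n $$ (m, (n - j) mod n))) / 2
      = refl_sign n j * l $ j * cos (2 * pi * real_of_int (int k + int m) * real j / real n) / real n" .
  qed
  finally show ?thesis by (simp add: cos_sum_def sum_divide_distrib)
qed

section \<open>Circulant and reverse circulant forms of \<open>C_set\<close> and
  \<open>B_set\<close>\<close>

lemma circ_entry_mod:
  assumes n: "n > 0" and km: "k < n" "m < n"
    and a: "\<And>i. i < n \<Longrightarrow> a $ i = cos_sum n u (int i)"
  shows "circ n a $$ (k, m) = cos_sum n u (int k - int m)"
proof -
  have "nat ((int m - int k) mod int n) < n" using n by (simp add: nat_less_iff)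
  then have "a $ nat ((int m - int k) mod int n) = cos_sum n u ((int m - int k) mod int n)"
    using a n by simp
  also have "\<dots> = cos_sum n u (int k - int m)"
    using cos_sum_mod[OF n] cos_sum_uminus[of n u "int m - int k"] by simp
  finally show ?thesis using km by (simp add: circ_def)
qed

lemma rcirc_entry_mod:
  assumes n: "n > 0" and km: "k < n" "m < n"
    and a: "\<And>i. i < n \<Longrightarrow> a $ i = cos_sum n u (int i)"
  shows "rcirc n a $$ (k, m) = cos_sum n u (int k + int m)"
  using a[of "(k + m) mod n"] n km cos_sum_mod[OF n, of u "int (k + m)"]
  by (simp add: rcirc_def of_nat_mod)

text \<open>The cosine transform leads from eigenvalues to entries, and its inverse leads back,
  since both vectors are symmetric.\<close>

lemma C_set_eq:
  assumes n: "n > 0"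
  shows "C_set n = {circ n a | a. symmetric_vec n a}"
proof (intro equalityI subsetI)
  fix C assume "C \<in> C_set n"
  then obtain l where l: "symmetric_vec n l" and C: "C = Q_conj_diag n l" by (auto simp: C_set_def)
  have "C = circ n (vec n (\<lambda>j. 1 * cos_sum n l (int j)))"
  proof (rule eq_matI)
    fix i j assume "i < dim_row (circ n (vec n (\<lambda>j. 1 * cos_sum n l (int j))))"
      "j < dim_col (circ n (vec n (\<lambda>j. 1 * cos_sum n l (int j))))"
    then have "i < n" "j < n" by (auto simp: circ_def)
    then show "C $$ (i, j) = circ n (vec n (\<lambda>j. 1 * cos_sum n l (int j))) $$ (i, j)"
      unfolding C using Q_conj_diag_symmetric_entry[OF l, of i j]
        circ_entry_mod[OF n, of i j "vec n (\<lambda>j. 1 * cos_sum n l (int j))" l] by simp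
  qed (use C Q_conj_diag_carrier[of n l] in \<open>auto simp: circ_def\<close>)
  with symmetric_cos_sum[OF n, of 1 l] show "C \<in> {circ n a | a. symmetric_vec n a}" by blast
next
  fix C assume "C \<in> {circ n a | a. symmetric_vec n a}"
  then obtain a where a: "symmetric_vec n a" and C: "C = circ n a" by auto
  define l where "l = vec n (\<lambda>j. real n * cos_sum n a (int j))"
  have l: "symmetric_vec n l" unfolding l_def by (rule symmetric_cos_sum[OF n])
  have "C = Q_conj_diag n l"
  proof (rule eq_matI)
    fix i j assume "i < dim_row (Q_conj_diag n l)" "j < dim_col (Q_conj_diag n l)"
    then have "i < n" "j < n" using Q_conj_diag_carrier[of n l] by auto
    then show "C $$ (i, j) = Q_conj_diag n l $$ (i, j)"
      unfolding C using Q_conj_diag_symmetric_entry[OF l, of i j]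
        circ_entry_mod[OF n, of i j a l] cos_sum_inverse[OF n a, folded l_def] by simp
  qed (use C Q_conj_diag_carrier[of n l] in \<open>auto simp: circ_def\<close>)
  with l show "C \<in> C_set n" by (auto simp: C_set_def)
qed

lemma B_set_subset_H1:
  assumes n: "n > 0"
  shows "B_set n \<subseteq> H1_set n"
proof
  fix B assume "B \<in> B_set n"
  then obtain l where l: "asymmetric_vec n l" and B: "B = Q_conj_diag n l" by (auto simp: B_set_def)
  define u where "u = vec n (\<lambda>j. refl_sign n j * l $ j)"
  define a where "a = vec n (\<lambda>j. 1 * cos_sum n u (int j))"
  have "B = rcirc n a"
  proof (rule eq_matI)
    fix i j assume "i < dim_row (rcirc n a)" "j < dim_col (rcirc n a)"
    then have "i < n" "j < n" by (auto simp: rcirc_def)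
    then show "B $$ (i, j) = rcirc n a $$ (i, j)"
      unfolding B using Q_conj_diag_asymmetric_entry[OF l, of i j]
        rcirc_entry_mod[OF n, of i j a u] by (simp add: u_def a_def)
  qed (use B Q_conj_diag_carrier[of n l] in \<open>auto simp: rcirc_def\<close>)
  with symmetric_cos_sum[OF n, of 1 u] show "B \<in> H1_set n" by (auto simp: H1_set_def a_def)
qed

text \<open>The two sum conditions say that the transform \<open>u\<close> of \<open>b\<close>
  vanishes at the self-paired frequencies \<open>0\<close> and \<open>n/2\<close>, exactly where
  \<open>refl_sign\<close> is zero. Elsewhere \<open>refl_sign\<close> squares to one, so the
  asymmetric eigenvalues \<open>refl_sign * u\<close> reproduce \<open>u\<close>.\<close>

lemma rcirc_mem_B_set:
  assumes n: "n > 0" and b: "symmetric_vec n b"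
    and sum0: "(\<Sum>j<n. b $ j) = 0" and alt0: "even n \<Longrightarrow> (\<Sum>j<n. (-1) ^ j * b $ j) = 0"
  shows "rcirc n b \<in> B_set n"
proof -
  define u where "u = vec n (\<lambda>j. real n * cos_sum n b (int j))"
  define l where "l = vec n (\<lambda>j. refl_sign n j * u $ j)"
  have u: "symmetric_vec n u" unfolding u_def by (rule symmetric_cos_sum[OF n])
  have l: "asymmetric_vec n l" unfolding asymmetric_vec_def
  proof (intro conjI allI impI)
    fix j assume j: "j < n"
    then have "u $ ((n - j) mod n) = u $ j" by (rule symmetric_vecD[OF u])
    then show "l $ j = - l $ ((n - j) mod n)"
      using j by (simp add: l_def refl_sign_reflect)
  qed (simp add: l_def)
  have u0: "u $ j = 0" if "j < n" "j = 0 \<or> 2 * j = n" for j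
  proof (cases "j = 0")
    case True
    then show ?thesis using n sum0 by (simp add: u_def cos_sum_def)
  next
    case False
    with that have j2: "2 * j = n" by simp
    then have rn: "real n = 2 * real j" by linarith
    have cosx: "cos (2 * pi * real_of_int (int j) * real k / real n) = (-1) ^ k" for k
    proof -
      have "2 * pi * real_of_int (int j) * real k / real n = real k * pi"
        using False by (simp add: rn field_simps)
      then show ?thesis by (simp add: cos_npi)
    qed
    have "even n" using j2 by auto
    from alt0[OF this] have "cos_sum n b (int j) = 0"
      unfolding cos_sum_def cosx by (simp add: mult.commute)
    with \<open>j < n\<close> show ?thesis by (simp add: u_def)
  qed
  have lu: "vec n (\<lambda>j. refl_sign n j * l $ j) = u"
    using u0 by (intro eq_vecI) (auto simp: l_def u_def refl_sign_def)
  have "rcirc n b = Q_conj_diag n l"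
  proof (rule eq_matI)
    fix i j assume "i < dim_row (Q_conj_diag n l)" "j < dim_col (Q_conj_diag n l)"
    then have "i < n" "j < n" using Q_conj_diag_carrier[of n l] by auto
    then show "rcirc n b $$ (i, j) = Q_conj_diag n l $$ (i, j)"
      using Q_conj_diag_asymmetric_entry[OF l, of i j, unfolded lu]
        rcirc_entry_mod[OF n, of i j b u] cos_sum_inverse[OF n b, folded u_def] by simp
  qed (use Q_conj_diag_carrier[of n l] in \<open>auto simp: rcirc_def\<close>)
  with l show ?thesis by (auto simp: B_set_def)
qed

section \<open>Orthogonality for the Frobenius inner product\<close>

definition frob_inner :: "nat \<Rightarrow> real mat \<Rightarrow> real mat \<Rightarrow> real" where
  "frob_inner n A B = (\<Sum>i<n. \<Sum>j<n. A $$ (i, j) * B $$ (i, j))"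

lemma frob_inner_cong:
  assumes "\<And>i j. i < n \<Longrightarrow> j < n \<Longrightarrow> A $$ (i, j) = A' $$ (i, j)"
    and "\<And>i j. i < n \<Longrightarrow> j < n \<Longrightarrow> B $$ (i, j) = B' $$ (i, j)"
  shows "frob_inner n A B = frob_inner n A' B'"
  unfolding frob_inner_def using assms by simp

lemma frob_inner_diff_left:
  assumes "A \<in> carrier_mat n n" "A' \<in> carrier_mat n n"
  shows "frob_inner n (A - A') B = frob_inner n A B - frob_inner n A' B"
  using assms by (simp add: frob_inner_def left_diff_distrib sum_subtractf)

lemma frob_inner_diff_right:
  assumes "B \<in> carrier_mat n n" "B' \<in> carrier_mat n n"
  shows "frob_inner n A (B - B') = frob_inner n A B - frob_inner n A B'"
  using assms by (simp add: frob_inner_def right_diff_distrib sum_subtractf)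

lemma frob_inner_add_right:
  assumes "B \<in> carrier_mat n n" "B' \<in> carrier_mat n n"
  shows "frob_inner n A (B + B') = frob_inner n A B + frob_inner n A B'"
  using assms by (simp add: frob_inner_def distrib_left sum.distrib)

lemma frob_inner_self_nonneg: "0 \<le> frob_inner n A A"
  unfolding frob_inner_def by (intro sum_nonneg) simp

lemma frob_inner_self_eq_0:
  assumes "frob_inner n A A = 0" "i < n" "j < n"
  shows "A $$ (i, j) = 0"
proof -
  have "(\<Sum>j<n. A $$ (i, j) * A $$ (i, j)) = 0"
    using assms(1,2) unfolding frob_inner_def
    by (subst (asm) sum_nonneg_eq_0_iff) (auto intro: sum_nonneg)
  then show ?thesis
    using assms(3) by (subst (asm) sum_nonneg_eq_0_iff) auto
qed

lemma frobenius_norm_eq: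
  "A \<in> carrier_mat n n \<Longrightarrow> frobenius_norm A = sqrt (frob_inner n A A)"
  by (simp add: frobenius_norm_def frob_inner_def power2_eq_square)

text \<open>Pythagoras gives minimality, and definiteness of the inner product gives uniqueness.
  Orthogonality is asked of the differences \<open>G - P\<close> only, so the lemma serves both sets
  of matrices.\<close>

lemma the_minimizer_orthogonal:
  assumes S: "S \<subseteq> carrier_mat n n" and T: "T \<in> carrier_mat n n" and P: "P \<in> S"
    and orth: "\<And>G. G \<in> S \<Longrightarrow> frob_inner n (T - P) (G - P) = 0"
  shows "the_minimizer (\<lambda>G. frobenius_norm (G - T)) S P"
proof -
  have Pc: "P \<in> carrier_mat n n" using S P by auto
  have pyth: "frob_inner n (G - T) (G - T) = frob_inner n (G - P) (G - P) + frob_inner n (P - T) (P - T)"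
    if G: "G \<in> S" for G
  proof -
    have Gc: "G \<in> carrier_mat n n" using S G by auto
    have "frob_inner n (G - T) (G - T) = frob_inner n (G - P) (G - P) + frob_inner n (P - T) (P - T)
        - 2 * frob_inner n (T - P) (G - P)"
      using Pc Gc T
      by (simp add: frob_inner_def sum_distrib_left algebra_simps flip: sum.distrib sum_subtractf)
    with orth[OF G] show ?thesis by simp
  qed
  have nf: "frobenius_norm (X - T) = sqrt (frob_inner n (X - T) (X - T))" for X
    by (rule frobenius_norm_eq[OF minus_carrier_mat[OF T]])
  have le: "frobenius_norm (P - T) \<le> frobenius_norm (G - T)" if "G \<in> S" for G
    using pyth[OF that] frob_inner_self_nonneg[of n "G - P"] T
    by (simp add: nf)
  have eq: "G = P" if G: "G \<in> S" and "frobenius_norm (G - T) \<le> frobenius_norm (P - T)" for G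
  proof -
    have Gc: "G \<in> carrier_mat n n" using S G by auto
    have "frob_inner n (G - P) (G - P) = 0"
      using pyth[OF G] that(2) frob_inner_self_nonneg[of n "G - P"] T
      by (simp add: nf)
    from frob_inner_self_eq_0[OF this] Gc Pc show ?thesis
      by (intro eq_matI) auto
  qed
  show ?thesis
    unfolding the_minimizer_def is_arg_min_def using P le eq by (meson not_less)
qed

text \<open>One nontrivial frequency suffices: the sum over its index vanishes for every phase
  contributed by the other index.\<close>

lemma sum_sum_cos_eq_0:
  fixes p q :: int
  assumes n: "n > 0" and pq: "\<not> int n dvd p \<or> \<not> int n dvd q"
  shows "(\<Sum>k<n. \<Sum>m<n. cos (2 * pi * real_of_int p * real k / real n
           + 2 * pi * real_of_int q * real m / real n)) = 0"
  using pq
proof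
  assume "\<not> int n dvd p"
  note z = sum_cos_eq_0[OF n this]
  show ?thesis
    by (subst sum.swap) (simp only: z sum.neutral_const)
next
  assume "\<not> int n dvd q"
  note z = sum_cos_eq_0[OF n this]
  show ?thesis
    by (subst add.commute) (simp only: z sum.neutral_const)
qed

text \<open>Membership of \<open>B\<close> in \<open>B_set\<close> matters here: the all-ones matrix
  is both a symmetric circulant and a symmetric reverse circulant. Each product of cosines splits
  into two with frequencies \<open>i + j\<close> and \<open>i - j\<close> in the row and column
  indices. If \<open>n\<close> divided both, it would divide \<open>2 * i\<close>, and there
  \<open>refl_sign\<close> is zero.\<close>

lemma frob_inner_B_C:
  assumes n: "n > 0" and B: "B \<in> B_set n" and C: "C \<in> C_set n"
  shows "frob_inner n B C = 0"
proof -
  from B obtain l where l: "asymmetric_vec n l" and B: "B = Q_conj_diag n l" by (auto simp: B_set_def)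
  from C obtain v where v: "symmetric_vec n v" and C: "C = Q_conj_diag n v" by (auto simp: C_set_def)
  define u where "u = vec n (\<lambda>j. refl_sign n j * l $ j)"
  have term0: "(\<Sum>k<n. \<Sum>m<n. u $ i * cos (2 * pi * real_of_int (int k + int m) * real i / real n)
           * (v $ j * cos (2 * pi * real_of_int (int k - int m) * real j / real n))) = 0"
    if ij: "i < n" "j < n" for i j
  proof (cases "i = 0 \<or> 2 * i = n")
    case True
    then have "u $ i = 0" using ij by (simp add: u_def refl_sign_def)
    then show ?thesis by simp
  next
    case False
    have ndvd: "\<not> int n dvd 2 * int i"
    proof
      assume "int n dvd 2 * int i"
      then have "n dvd 2 * i" by (metis int_dvd_int_iff of_nat_mult of_nat_numeral)
      then obtain q where q: "2 * i = n * q" by auto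
      then have "n * q < n * 2" using ij by linarith
      then have "q < 2" by simp
      then have "q = 0 \<or> q = 1" by auto
      with q False show False by auto
    qed
    define e where "e = int i + int j"
    define f where "f = int i - int j"
    have ef: "\<not> int n dvd e \<or> \<not> int n dvd f"
    proof (rule ccontr)
      assume "\<not> (\<not> int n dvd e \<or> \<not> int n dvd f)"
      then have "int n dvd e + f" by simp
      with ndvd show False by (simp add: e_def f_def)
    qed
    have split: "u $ i * cos (2 * pi * real_of_int (int k + int m) * real i / real n)
           * (v $ j * cos (2 * pi * real_of_int (int k - int m) * real j / real n))
        = u $ i * v $ j / 2 * (cos (2 * pi * real_of_int e * real k / real n + 2 * pi * real_of_int f * real m / real n)
          + cos (2 * pi * real_of_int f * real k / real n + 2 * pi * real_of_int e * real m / real n))" for k m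
    proof -
      define x where "x = 2 * pi * real_of_int (int k + int m) * real i / real n"
      define y where "y = 2 * pi * real_of_int (int k - int m) * real j / real n"
      have 1: "2 * pi * real_of_int e * real k / real n + 2 * pi * real_of_int f * real m / real n = x + y"
        "2 * pi * real_of_int f * real k / real n + 2 * pi * real_of_int e * real m / real n = x - y"
        unfolding x_def y_def e_def f_def
        by (simp_all add: algebra_simps diff_divide_distrib add_divide_distrib)
      show ?thesis unfolding 1 x_def[symmetric] y_def[symmetric] cos_add cos_diff by simp
    qed
    show ?thesis
      unfolding split sum_distrib_left[symmetric] sum.distrib
      using ef by (simp only: sum_sum_cos_eq_0[OF n] disj_commute) simp
  qed
  have "frob_inner n B C = (\<Sum>k<n. \<Sum>m<n. cos_sum n u (int k + int m) * cos_sum n v (int k - int m))"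
    unfolding frob_inner_def B C u_def
    using Q_conj_diag_asymmetric_entry[OF l] Q_conj_diag_symmetric_entry[OF v] by simp
  also have "\<dots> = (\<Sum>k<n. \<Sum>m<n. \<Sum>i<n. \<Sum>j<n. u $ i * cos (2 * pi * real_of_int (int k + int m) * real i / real n)
           * (v $ j * cos (2 * pi * real_of_int (int k - int m) * real j / real n))) / (real n * real n)"
    unfolding cos_sum_def times_divide_times_eq sum_product sum_divide_distrib[symmetric] ..
  also have "(\<Sum>k<n. \<Sum>m<n. \<Sum>i<n. \<Sum>j<n. u $ i * cos (2 * pi * real_of_int (int k + int m) * real i / real n)
           * (v $ j * cos (2 * pi * real_of_int (int k - int m) * real j / real n)))
      = (\<Sum>i<n. \<Sum>j<n. \<Sum>k<n. \<Sum>m<n. u $ i * cos (2 * pi * real_of_int (int k + int m) * real i / real n)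
           * (v $ j * cos (2 * pi * real_of_int (int k - int m) * real j / real n)))"
    (is "(\<Sum>k<n. \<Sum>m<n. \<Sum>i<n. \<Sum>j<n. ?f k m i j) = _")
  proof -
    have "(\<Sum>k<n. \<Sum>m<n. \<Sum>i<n. \<Sum>j<n. ?f k m i j) = (\<Sum>k<n. \<Sum>i<n. \<Sum>m<n. \<Sum>j<n. ?f k m i j)"
      by (intro sum.cong refl sum.swap)
    also have "\<dots> = (\<Sum>i<n. \<Sum>k<n. \<Sum>m<n. \<Sum>j<n. ?f k m i j)" by (rule sum.swap)
    also have "\<dots> = (\<Sum>i<n. \<Sum>k<n. \<Sum>j<n. \<Sum>m<n. ?f k m i j)"
      by (intro sum.cong refl sum.swap)
    also have "\<dots> = (\<Sum>i<n. \<Sum>j<n. \<Sum>k<n. \<Sum>m<n. ?f k m i j)"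
      by (intro sum.cong refl sum.swap)
    finally show ?thesis .
  qed
  also have "\<dots> = 0" by (intro sum.neutral ballI term0) auto
  finally show ?thesis by simp
qed

section \<open>Passing between \<open>G_set\<close> and \<open>G_hat_set\<close>\<close>

lemma Q_conj_diag_add:
  assumes "\<And>j. j < n \<Longrightarrow> l $ j = l1 $ j + l2 $ j"
  shows "Q_conj_diag n l = Q_conj_diag n l1 + Q_conj_diag n l2"
proof (rule eq_matI)
  fix i j assume "i < dim_row (Q_conj_diag n l1 + Q_conj_diag n l2)" "j < dim_col (Q_conj_diag n l1 + Q_conj_diag n l2)"
  then have ij: "i < n" "j < n"
    using Q_conj_diag_carrier[of n l2] by auto
  then show "Q_conj_diag n l $$ (i, j) = (Q_conj_diag n l1 + Q_conj_diag n l2) $$ (i, j)"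
    using Q_conj_diag_carrier[of n l1] Q_conj_diag_carrier[of n l2]
    by (simp add: Q_conj_diag_entry assms distrib_right sum.distrib)
qed (use Q_conj_diag_carrier[of n l] Q_conj_diag_carrier[of n l2] in auto)

lemma C_plus_B_mem_G_set:
  assumes "C \<in> C_set n" "B \<in> B_set n"
  shows "C + B \<in> G_set n"
proof -
  from assms obtain l1 l2 where l: "symmetric_vec n l1" "C = Q_conj_diag n l1"
    "asymmetric_vec n l2" "B = Q_conj_diag n l2" by (auto simp: C_set_def B_set_def)
  have "Q_conj_diag n (vec n (\<lambda>j. l1 $ j + l2 $ j)) = C + B"
    unfolding l by (rule Q_conj_diag_add) simp
  then show ?thesis unfolding G_set_def by (metis (mono_tags, lifting) mem_Collect_eq vec_carrier)
qed

text \<open>Splits the eigenvalue vector into its symmetric and asymmetric parts under index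
  reflection.\<close>

lemma G_set_subset_G_hat_set:
  assumes n: "n > 0"
  shows "G_set n \<subseteq> G_hat_set n"
proof
  fix G assume "G \<in> G_set n"
  then obtain l where G: "G = Q_conj_diag n l" by (auto simp: G_set_def)
  define r where "r j = (n - j) mod n" for j
  have rr: "r (r j) = j" "r j < n" if "j < n" for j
    using that by (cases "j = 0", auto simp: r_def)+
  define l1 where "l1 = vec n (\<lambda>j. (l $ j + l $ r j) / 2)"
  define l2 where "l2 = vec n (\<lambda>j. (l $ j - l $ r j) / 2)"
  have "symmetric_vec n l1" unfolding symmetric_vec_def r_def[symmetric]
    using rr by (simp add: l1_def add.commute)
  moreover have "asymmetric_vec n l2" unfolding asymmetric_vec_def r_def[symmetric]
    using rr by (simp add: l2_def field_simps)
  moreover have "Q_conj_diag n l = Q_conj_diag n l1 + Q_conj_diag n l2"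
    by (rule Q_conj_diag_add) (simp add: l1_def l2_def field_simps)
  ultimately show "G \<in> G_hat_set n"
    unfolding G G_hat_set_def C_set_def using B_set_subset_H1[OF n] unfolding B_set_def by blast
qed

section \<open>Projecting a Toeplitz matrix\<close>

text \<open>Generates the residue of the circulant projection, again a symmetric Toeplitz matrix.\<close>

definition toeplitz_defect :: "nat \<Rightarrow> (nat \<Rightarrow> real) \<Rightarrow> nat \<Rightarrow> real" where
  "toeplitz_defect n t j = real j / real n * (t j - t (n - j))"

lemma symmetric_c_coeffs: "symmetric_vec n (c_coeffs n t)"
  unfolding symmetric_vec_def
proof (intro conjI allI impI)
  fix j assume "j < n"
  then show "c_coeffs n t $ j = c_coeffs n t $ ((n - j) mod n)"
    by (cases "j = 0") (auto simp: c_coeffs_def add.commute)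
qed (simp add: c_coeffs_def)

text \<open>A symmetric circulant is a symmetric Toeplitz matrix: below the diagonal the wrapped
  index \<open>n - (k - m)\<close> is the mirror of \<open>k - m\<close>.\<close>

lemma circ_symmetric_entry:
  assumes a: "symmetric_vec n a" and km: "k < n" "m < n"
  shows "circ n a $$ (k, m) = a $ nat \<bar>int k - int m\<bar>"
proof (cases "k \<le> m")
  case True
  then have "(int m - int k) mod int n = int m - int k" using km by simp
  with True km show ?thesis by (simp add: circ_def)
next
  case False
  have "(int m - int k) mod int n = (int m - int k + int n) mod int n" by simp
  also have "\<dots> = int m - int k + int n" using False km by (intro mod_pos_pos_trivial) auto
  finally have "nat ((int m - int k) mod int n) = (n - (k - m)) mod n" using False km by simp
  moreover have "nat \<bar>int k - int m\<bar> = k - m" using False by simp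
  moreover have "a $ ((n - (k - m)) mod n) = a $ (k - m)" using km by (intro symmetric_vecD[OF a]) simp
  moreover have "circ n a $$ (k, m) = a $ nat ((int m - int k) mod int n)"
    using km by (simp add: circ_def)
  ultimately show ?thesis by (simp only:)
qed

lemma sym_toeplitz_minus_circ:
  assumes km: "k < n" "m < n"
  shows "sym_toeplitz n t $$ (k, m) - circ n (c_coeffs n t) $$ (k, m)
       = sym_toeplitz n (toeplitz_defect n t) $$ (k, m)"
proof -
  define j where "j = nat \<bar>int k - int m\<bar>"
  have j: "j < n" using km by (auto simp: j_def)
  have "t j - c_coeffs n t $ j = toeplitz_defect n t j"
  proof (cases "j = 0")
    case True
    with j show ?thesis by (simp add: c_coeffs_def toeplitz_defect_def)
  next
    case False
    with j show ?thesis
      by (simp add: c_coeffs_def toeplitz_defect_def of_nat_diff field_simps)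
  qed
  then show ?thesis
    using km circ_symmetric_entry[OF symmetric_c_coeffs km] by (simp add: sym_toeplitz_def j_def)
qed

text \<open>A positive distance \<open>j\<close> occurs \<open>2 * (n - j)\<close> times but
  distance zero only \<open>n\<close> times; the extra \<open>n * f 0\<close> makes the weights
  uniform.\<close>

lemma sum_toeplitz:
  fixes f :: "nat \<Rightarrow> real"
  shows "(\<Sum>k<n. \<Sum>m<n. f (nat \<bar>int k - int m\<bar>)) + real n * f 0 = 2 * (\<Sum>j<n. real (n - j) * f j)"
proof (induction n)
  case (Suc n)
  \<comment> \<open>The last column and the last row run through the distances \<open>n\<close> down
    to \<open>1\<close>; reindexing reverses this order.\<close>
  have edge: "(\<Sum>k<n. f (nat \<bar>int k - int n\<bar>)) = (\<Sum>j<n. f (Suc j))"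
    "(\<Sum>m<n. f (nat \<bar>int n - int m\<bar>)) = (\<Sum>j<n. f (Suc j))"
  proof -
    have "(\<Sum>k<n. f (nat \<bar>int k - int n\<bar>)) = (\<Sum>k<n. f (Suc (n - Suc k)))"
      "(\<Sum>m<n. f (nat \<bar>int n - int m\<bar>)) = (\<Sum>k<n. f (Suc (n - Suc k)))"
      by (auto intro!: sum.cong arg_cong[where f = f])
    from this[THEN trans, OF sum.nat_diff_reindex]
    show "(\<Sum>k<n. f (nat \<bar>int k - int n\<bar>)) = (\<Sum>j<n. f (Suc j))"
      "(\<Sum>m<n. f (nat \<bar>int n - int m\<bar>)) = (\<Sum>j<n. f (Suc j))" .
  qed
  have "(\<Sum>j<Suc n. real (Suc n - j) * f j) = (\<Sum>j<Suc n. real (n - j) * f j + f j)"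
    by (intro sum.cong refl) (simp add: of_nat_diff algebra_simps)
  also have "\<dots> = (\<Sum>j<n. real (n - j) * f j) + (f 0 + (\<Sum>j<n. f (Suc j)))"
    using sum.lessThan_Suc_shift[of f n] by (simp add: sum.distrib del: sum.lessThan_Suc) simp
  finally have w: "(\<Sum>j<Suc n. real (Suc n - j) * f j)
    = (\<Sum>j<n. real (n - j) * f j) + (f 0 + (\<Sum>j<n. f (Suc j)))" .
  have "(\<Sum>k<Suc n. \<Sum>m<Suc n. f (nat \<bar>int k - int m\<bar>))
      = (\<Sum>k<n. \<Sum>m<n. f (nat \<bar>int k - int m\<bar>)) + 2 * (\<Sum>j<n. f (Suc j)) + f 0"
    by (simp only: sum.lessThan_Suc sum.distrib edge) simp
  with Suc show ?case unfolding w by (simp add: algebra_simps)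
qed simp

text \<open>Distance \<open>j\<close> enters with weight
  \<open>(n - j) * j / n * (t j - t (n - j))\<close>, which changes sign under \<open>j\<close> to
  \<open>n - j\<close> while \<open>a\<close> does not, so mirror terms cancel.\<close>

lemma frob_inner_defect_circ:
  assumes n: "n > 0" and a: "symmetric_vec n a"
  shows "frob_inner n (sym_toeplitz n (toeplitz_defect n t)) (circ n a) = 0"
proof -
  define f where "f j = toeplitz_defect n t j * a $ j" for j
  define g where "g j = real (n - j) * f j" for j
  have f0: "f 0 = 0" by (simp add: f_def toeplitz_defect_def)
  have "frob_inner n (sym_toeplitz n (toeplitz_defect n t)) (circ n a)
      = (\<Sum>k<n. \<Sum>m<n. f (nat \<bar>int k - int m\<bar>))"
    unfolding frob_inner_def f_def
    by (intro sum.cong refl) (simp add: sym_toeplitz_def circ_symmetric_entry[OF a])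
  also have "\<dots> = 2 * (\<Sum>j<n. g j)"
    using sum_toeplitz[of f n] f0 by (simp add: g_def)
  also have "(\<Sum>j<n. g j) = (\<Sum>j<n. (g j + g ((n - j) mod n)) / 2)" by (rule sum_symmetrize)
  also have "\<dots> = 0"
  proof (intro sum.neutral ballI)
    fix j assume "j \<in> {..<n}"
    then have j: "j < n" by simp
    show "(g j + g ((n - j) mod n)) / 2 = 0"
    proof (cases "j = 0")
      case True
      then show ?thesis by (simp add: g_def f0)
    next
      case False
      then have "a $ (n - j) = a $ j" using symmetric_vecD[OF a j] j by simp
      with False j n show ?thesis
        by (simp add: g_def f_def toeplitz_defect_def field_simps)
    qed
  qed
  finally show ?thesis by simp
qed

section \<open>Antidiagonal sums and the coefficients \<open>b_coeffs\<close>\<close>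

text \<open>The sum of the entries of the Toeplitz matrix of \<^term>\<open>d\<close> at the \<^term>\<open>N\<close>
  positions \<^term>\<open>(i, N - 1 - i)\<close>; the shift by one makes the empty antidiagonal available as \<^term>\<open>N = 0\<close>.\<close>

definition antidiag :: "(nat \<Rightarrow> real) \<Rightarrow> nat \<Rightarrow> real" where
  "antidiag d N = (\<Sum>i<N. d (nat \<bar>int N - 1 - 2 * int i\<bar>))"

lemma antidiag_0: "antidiag d 0 = 0" by (simp add: antidiag_def)

lemma antidiag_1: "antidiag d (Suc 0) = d 0" by (simp add: antidiag_def)

text \<open>The two end positions both have distance \<open>N + 1\<close> from the diagonal;
  removing them leaves the antidiagonal shorter by two.\<close>

lemma antidiag_Suc_Suc: "antidiag d (Suc (Suc N)) = 2 * d (Suc N) + antidiag d N"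
proof -
  have "antidiag d (Suc (Suc N)) = d (nat \<bar>int (Suc N)\<bar>)
      + (\<Sum>i<N. d (nat \<bar>int (Suc (Suc N)) - 1 - 2 * int (Suc i)\<bar>))
      + d (nat \<bar>int (Suc (Suc N)) - 1 - 2 * int (Suc N)\<bar>)"
    unfolding antidiag_def
    by (subst sum.lessThan_Suc_shift, subst sum.lessThan_Suc) simp
  moreover have "(\<Sum>i<N. d (nat \<bar>int (Suc (Suc N)) - 1 - 2 * int (Suc i)\<bar>)) = antidiag d N"
    unfolding antidiag_def by (intro sum.cong refl arg_cong[where f = d]) auto
  moreover have "nat \<bar>int (Suc (Suc N)) - 1 - 2 * int (Suc N)\<bar> = Suc N" by simp
  ultimately show ?thesis by (simp add: nat_add_distrib)
qed

text \<open>An antidiagonal of even length meets odd distances only, each of them twice.\<close>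

lemma odd_sum_antidiag: "2 * odd_sum n t m = antidiag (toeplitz_defect n t) (2 * m)"
proof (induction m)
  case (Suc m)
  have "2 * odd_sum n t (Suc m) = 2 * odd_sum n t m + 2 * toeplitz_defect n t (Suc (2 * m))"
    by (simp add: odd_sum_def toeplitz_defect_def algebra_simps)
  with Suc show ?case by (simp add: antidiag_Suc_Suc)
qed (simp add: odd_sum_def antidiag_0)

text \<open>An antidiagonal of odd length meets even distances, the positive ones twice; its central
  entry at distance zero vanishes for the defect.\<close>

lemma even_sum_antidiag: "2 * even_sum n t (Suc m) = antidiag (toeplitz_defect n t) (Suc (2 * m))"
proof (induction m)
  case 0
  then show ?case by (simp add: even_sum_def antidiag_1 toeplitz_defect_def)
next
  case (Suc m)
  have "2 * even_sum n t (Suc (Suc m)) = 2 * even_sum n t (Suc m) + 2 * toeplitz_defect n t (Suc (Suc (2 * m)))"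
    by (simp add: even_sum_def toeplitz_defect_def algebra_simps)
  with Suc show ?case by (simp add: antidiag_Suc_Suc)
qed

lemma odd_sum_eq:
  assumes "odd j" shows "odd_sum n t ((j - 1) div 2) = antidiag (toeplitz_defect n t) (j - 1) / 2"
proof -
  have "2 * ((j - 1) div 2) = j - 1" using assms by auto
  then show ?thesis using odd_sum_antidiag[of n t "(j - 1) div 2"] by simp
qed

text \<open>Together with \<open>odd_sum_eq\<close>: whichever sum the parity of \<open>j\<close>
  selects, it is half the antidiagonal of length \<open>j - 1\<close>. This removes the parity cases
  from \<open>b_coeffs\<close>.\<close>

lemma even_sum_eq:
  assumes "even j" "j > 0" shows "even_sum n t (j div 2) = antidiag (toeplitz_defect n t) (j - 1) / 2"
proof -
  obtain i where i: "j = 2 * i" using assms by auto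
  with assms obtain i' where "i = Suc i'" by (cases i) auto
  with i even_sum_antidiag[of n t i'] show ?thesis by simp
qed

lemma b_coeffs_0:
  assumes "n > 0"
  shows "b_coeffs n t $ 0 = antidiag (toeplitz_defect n t) (n - 1) / real n"
  using assms even_sum_eq[of n n t] odd_sum_eq[of n n t] by (auto simp: b_coeffs_def Let_def mult.commute)

text \<open>The auxiliary \<open>h\<close> picks the sum that fits the parity of its index. The
  leading term is \<open>2 * (d j + d (n - j))\<close>, because the two defects are multiples of the
  same difference \<open>t j - t (n - j)\<close>, with weights \<open>j / n\<close> and
  \<open>- (n - j) / n\<close>.\<close>

lemma b_coeffs_pos:
  fixes t d :: "nat \<Rightarrow> real"
  assumes "0 < j" "j < n"
  defines "d \<equiv> toeplitz_defect n t"
  shows "b_coeffs n t $ j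
       = (d j + d (n - j) + antidiag d (j - 1) + antidiag d (n - j - 1)) / real n"
proof -
  define h where "h i = (if odd i then odd_sum n t ((i - 1) div 2) else even_sum n t (i div 2))" for i
  have h: "h i = antidiag d (i - 1) / 2" if "i > 0" for i
    using that odd_sum_eq[of i n t] even_sum_eq[of i n t] by (simp add: h_def d_def)
  define lead where "lead = (4 * real j - 2 * real n) / real n * (t j - t (n - j))"
  have lead: "lead = 2 * (d j + d (n - j))"
    using assms(1,2) by (simp add: lead_def d_def toeplitz_defect_def of_nat_diff field_simps)
  have "b_coeffs n t $ j = 1 / (2 * real n) * (lead + 4 * h j + 4 * h (n - j))"
  \<comment> \<open>At \<open>j = n/2\<close> the leading term is zero and the two sums coincide, so
    the general formula collapses to the one with factor \<open>4 / n\<close>.\<close>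
  proof (cases "even n \<and> j = n div 2")
    case True
    then have n2: "n = 2 * j" by auto
    have nj: "n - j = j" using n2 by simp
    have l0: "lead = 0" by (simp add: lead_def n2)
    show ?thesis
    proof (cases "even j")
      case True
      then obtain i where i: "j = 2 * i" by auto
      have "b_coeffs n t $ j = 4 / real n * even_sum n t (n div 4)"
        using assms(1,2) by (simp add: b_coeffs_def n2 i)
      moreover have "n div 4 = j div 2" by (simp add: n2 i)
      ultimately show ?thesis using True by (simp add: l0 nj h_def)
    next
      case False
      then obtain i where i: "j = 2 * i + 1" by (auto elim: oddE)
      have "\<not> 4 dvd n" unfolding n2 i by presburger
      then have "b_coeffs n t $ j = 4 / real n * odd_sum n t (n div 4)"
        using assms(1,2) n2 by (simp add: b_coeffs_def)
      moreover have "n div 4 = (j - 1) div 2" by (simp add: n2 i)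
      ultimately show ?thesis using False by (simp add: l0 nj h_def)
    qed
  next
    case False
    have "odd (n - j) \<longleftrightarrow> (odd n \<noteq> odd j)" using assms(2) by auto
    with False assms(1,2) show ?thesis
      by (auto simp: b_coeffs_def Let_def h_def lead_def)
  qed
  also have "\<dots> = (d j + d (n - j) + antidiag d (j - 1) + antidiag d (n - j - 1)) / real n"
    using assms(1,2) by (simp add: h lead field_simps)
  finally show ?thesis .
qed

lemma symmetric_b_coeffs: "symmetric_vec n (b_coeffs n t)"
  unfolding symmetric_vec_def
proof (intro conjI allI impI)
  fix j assume "j < n"
  then show "b_coeffs n t $ j = b_coeffs n t $ ((n - j) mod n)"
    by (cases "j = 0") (auto simp: b_coeffs_pos add_ac)
qed (simp add: b_coeffs_def)

text \<open>The terms \<open>2 * d j\<close> and \<open>2 * d (n - j)\<close> each lengthen an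
  antidiagonal by two. The result is the total of the residue over the index classes
  \<open>j\<close> and \<open>n - j\<close> modulo \<open>n\<close>.\<close>

lemma b_coeffs_antidiag:
  fixes t d :: "nat \<Rightarrow> real"
  assumes "0 < j" "j < n"
  defines "d \<equiv> toeplitz_defect n t"
  shows "2 * (real n * b_coeffs n t $ j)
    = antidiag d (Suc j) + antidiag d (n - 1 - j) + (antidiag d (Suc (n - j)) + antidiag d (j - 1))"
proof -
  have "antidiag d (Suc i) = 2 * d i + antidiag d (i - 1)" if "i > 0" for i
    using that antidiag_Suc_Suc[of d "i - 1"] by simp
  from this[of j] this[of "n - j"] assms(1,2) show ?thesis
    by (simp add: b_coeffs_pos d_def diff_right_commute)
qed

section \<open>Inner products with reverse circulants\<close>

text \<open>The part strictly below the main antidiagonal is traversed after a half turn of the square.\<close>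

lemma sum_square_antidiagonals:
  fixes h :: "nat \<Rightarrow> nat \<Rightarrow> real"
  shows "(\<Sum>k<n. \<Sum>m<n. h k m) = (\<Sum>p<n. \<Sum>i\<le>p. h i (p - i))
    + (\<Sum>p<n - 1. \<Sum>i\<le>p. h (n - 1 - i) (n - 1 - (p - i)))"
proof -
  have tri: "(\<Sum>k<N. \<Sum>m<N. if k + m < M then f k m else 0) = (\<Sum>p<M. \<Sum>i\<le>p. f i (p - i))"
    if "M \<le> N" for N M and f :: "nat \<Rightarrow> nat \<Rightarrow> real"
  proof -
    have "(\<Sum>k<N. \<Sum>m<N. if k + m < M then f k m else 0)
        = (\<Sum>(k, m)\<in>{..<N} \<times> {..<N}. if k + m < M then f k m else 0)"
      by (rule sum.cartesian_product)
    also have "\<dots> = (\<Sum>(k, m)\<in>{(k, m). k + m < M}. f k m)"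
      by (rule sum.mono_neutral_cong_right) (use that in \<open>auto split: if_splits\<close>)
    also have "\<dots> = (\<Sum>p<M. \<Sum>i\<le>p. f i (p - i))" by (rule sum.triangle_reindex)
    finally show ?thesis .
  qed
  have "(\<Sum>k<n. \<Sum>m<n. h k m) = (\<Sum>k<n. \<Sum>m<n. if k + m < n then h k m else 0)
      + (\<Sum>k<n. \<Sum>m<n. if k + m < n then 0 else h k m)"
    unfolding sum.distrib[symmetric] by (intro sum.cong refl) simp
  also have "(\<Sum>k<n. \<Sum>m<n. if k + m < n then 0 else h k m)
      = (\<Sum>k<n. \<Sum>m<n. if (n - Suc k) + (n - Suc m) < n then 0 else h (n - Suc k) (n - Suc m))"
    by (simp only: sum.nat_diff_reindex[of "\<lambda>m. if i + m < n then 0 else h i m" for i]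
        sum.nat_diff_reindex[of "\<lambda>k. \<Sum>m<n. if k + m < n then 0 else h k m"])
  \<comment> \<open>After the half turn, an index sum of at least \<open>n\<close> becomes one of at
    most \<open>n - 2\<close>.\<close>
  also have "\<dots> = (\<Sum>k<n. \<Sum>m<n. if k + m < n - 1 then h (n - 1 - k) (n - 1 - m) else 0)"
    by (intro sum.cong refl) auto
  finally show ?thesis by (simp only: tri[OF le_refl] tri[OF diff_le_self])
qed

text \<open>The coefficient \<open>a $ m\<close> sits on the antidiagonals with index sum
  \<open>m\<close> and \<open>m + n\<close>, of lengths \<open>m + 1\<close> and
  \<open>n - 1 - m\<close>. The half turn used for the second preserves the distance from the
  diagonal.\<close>

lemma frob_inner_toeplitz_rcirc:
  "frob_inner n (sym_toeplitz n d) (rcirc n a)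
     = (\<Sum>m<n. a $ m * (antidiag d (Suc m) + antidiag d (n - 1 - m)))"
proof -
  define h where "h k m = d (nat \<bar>int k - int m\<bar>) * a $ ((k + m) mod n)" for k m
  have A: "antidiag d (Suc p) = (\<Sum>i\<le>p. d (nat \<bar>int i - int (p - i)\<bar>))" for p
    unfolding antidiag_def lessThan_Suc_atMost
    by (intro sum.cong refl arg_cong[where f = d]) auto
  have "frob_inner n (sym_toeplitz n d) (rcirc n a) = (\<Sum>k<n. \<Sum>m<n. h k m)"
    unfolding frob_inner_def h_def by (simp add: sym_toeplitz_def rcirc_def)
  also have "\<dots> = (\<Sum>p<n. \<Sum>i\<le>p. h i (p - i))
    + (\<Sum>p<n - 1. \<Sum>i\<le>p. h (n - 1 - i) (n - 1 - (p - i)))"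
    by (rule sum_square_antidiagonals)
  also have "(\<Sum>p<n. \<Sum>i\<le>p. h i (p - i)) = (\<Sum>p<n. a $ p * antidiag d (Suc p))"
    unfolding A sum_distrib_left by (intro sum.cong refl) (simp add: h_def)
  \<comment> \<open>The length \<open>Suc p\<close> is written redundantly so that the whole summand
    is a function of \<open>n - 1 - Suc p\<close>, ready for reversing the order of
    summation.\<close>
  also have "(\<Sum>p<n - 1. \<Sum>i\<le>p. h (n - 1 - i) (n - 1 - (p - i)))
      = (\<Sum>p<n - 1. a $ (n - 1 - Suc p) * antidiag d (n - 1 - (n - 1 - Suc p)))"
  proof (rule sum.cong[OF refl])
    fix p assume "p \<in> {..<n - 1}"
    then have p: "p < n - 1" by simp
    have "h (n - 1 - i) (n - 1 - (p - i)) = a $ (n - 1 - Suc p) * d (nat \<bar>int i - int (p - i)\<bar>)"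
      if "i \<le> p" for i
    proof -
      have "n - 1 - i + (n - 1 - (p - i)) = (n - 1 - Suc p) + n" using that p by linarith
      then have "(n - 1 - i + (n - 1 - (p - i))) mod n = (n - 1 - Suc p) mod n"
        by (simp only: mod_add_self2)
      also have "\<dots> = n - 1 - Suc p" using p by (intro mod_less) auto
      finally have "(n - 1 - i + (n - 1 - (p - i))) mod n = n - 1 - Suc p" .
      moreover have "nat \<bar>int (n - 1 - i) - int (n - 1 - (p - i))\<bar> = nat \<bar>int i - int (p - i)\<bar>"
      proof -
        have "int (n - 1 - i) - int (n - 1 - (p - i)) = int (p - i) - int i"
          using that p by (simp add: of_nat_diff)
        then show ?thesis by (simp only: abs_minus_commute)
      qed
      ultimately show ?thesis by (simp add: h_def)
    qed
    moreover have "n - 1 - (n - 1 - Suc p) = Suc p" using p by simp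
    ultimately show "(\<Sum>i\<le>p. h (n - 1 - i) (n - 1 - (p - i)))
      = a $ (n - 1 - Suc p) * antidiag d (n - 1 - (n - 1 - Suc p))"
      by (simp add: A sum_distrib_left)
  qed
  also have "\<dots> = (\<Sum>p<n - 1. a $ p * antidiag d (n - 1 - p))"
    by (rule sum.nat_diff_reindex)
  \<comment> \<open>The added index \<open>n - 1\<close> contributes an empty antidiagonal.\<close>
  also have "\<dots> = (\<Sum>p<n. a $ p * antidiag d (n - 1 - p))"
    by (cases n) (simp_all add: antidiag_0)
  finally show ?thesis by (simp add: distrib_left sum.distrib)
qed

lemma sum_add_mod:
  fixes f :: "nat \<Rightarrow> real"
  assumes k: "k < n"
  shows "(\<Sum>m<n. f ((k + m) mod n)) = (\<Sum>m<n. f m)"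
proof -
  have inv: "(k + (n - k + j) mod n) mod n = j" "(n - k + (k + j) mod n) mod n = j" if "j < n" for j
  proof -
    have "(k + (n - k + j) mod n) mod n = (k + (n - k + j)) mod n" by (rule mod_add_right_eq)
    also have "k + (n - k + j) = n + j" using k by simp
    finally show "(k + (n - k + j) mod n) mod n = j" using that by simp
    have "(n - k + (k + j) mod n) mod n = (n - k + (k + j)) mod n" by (rule mod_add_right_eq)
    also have "n - k + (k + j) = n + j" using k by simp
    finally show "(n - k + (k + j) mod n) mod n = j" using that by simp
  qed
  have "bij_betw (\<lambda>m. (k + m) mod n) {..<n} {..<n}"
    by (rule bij_betwI[where g = "\<lambda>j. (n - k + j) mod n"]) (use k inv in auto)
  then show ?thesis by (rule sum.reindex_bij_betw)
qed

lemma frob_inner_rcirc_rcirc: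
  "frob_inner n (rcirc n b) (rcirc n a) = real n * (\<Sum>m<n. b $ m * a $ m)"
proof -
  have "frob_inner n (rcirc n b) (rcirc n a)
      = (\<Sum>k<n. \<Sum>m<n. b $ ((k + m) mod n) * a $ ((k + m) mod n))"
    unfolding frob_inner_def by (simp add: rcirc_def)
  also have "\<dots> = (\<Sum>k<n. \<Sum>m<n. b $ m * a $ m)"
    by (rule sum.cong[OF refl]) (rule sum_add_mod[of _ n "\<lambda>m. b $ m * a $ m"], simp)
  finally show ?thesis by simp
qed

text \<open>For symmetric \<open>a\<close> only the mirror sums of the antidiagonal totals
  \<open>s\<close> matter, and these are \<open>2 * n\<close> times the entries of
  \<open>b_coeffs\<close>. So the residue minus its reverse circulant is orthogonal to
  \<open>H1_set\<close>.\<close>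

lemma frob_inner_defect_rcirc:
  assumes n: "n > 0" and a: "symmetric_vec n a"
  shows "frob_inner n (sym_toeplitz n (toeplitz_defect n t)) (rcirc n a)
       = frob_inner n (rcirc n (b_coeffs n t)) (rcirc n a)"
proof -
  define d where "d = toeplitz_defect n t"
  define s where "s m = antidiag d (Suc m) + antidiag d (n - 1 - m)" for m
  have d0: "d 0 = 0" by (simp add: d_def toeplitz_defect_def)
  have "frob_inner n (sym_toeplitz n d) (rcirc n a) = (\<Sum>m<n. a $ m * s m)"
    unfolding s_def by (rule frob_inner_toeplitz_rcirc)
  also have "\<dots> = (\<Sum>m<n. (a $ m * s m + a $ ((n - m) mod n) * s ((n - m) mod n)) / 2)"
    by (rule sum_symmetrize)
  also have "\<dots> = (\<Sum>m<n. real n * (b_coeffs n t $ m * a $ m))"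
  proof (rule sum.cong[OF refl])
    fix m assume "m \<in> {..<n}"
    then have m: "m < n" by simp
    have "s m + s ((n - m) mod n) = 2 * (real n * b_coeffs n t $ m)"
    \<comment> \<open>Index \<open>0\<close> is its own mirror; its class consists of the main
      diagonal corner, where the defect is zero, and the antidiagonal of length
      \<open>n - 1\<close>.\<close>
    proof (cases "m = 0")
      case True
      with n show ?thesis by (simp add: s_def b_coeffs_0 antidiag_1 d0 flip: d_def)
    next
      case False
      then have "0 < m" by simp
      from b_coeffs_antidiag[OF this m, of t, folded d_def] False m show ?thesis
        by (simp add: s_def)
    qed
    then show "(a $ m * s m + a $ ((n - m) mod n) * s ((n - m) mod n)) / 2
        = real n * (b_coeffs n t $ m * a $ m)"
      unfolding symmetric_vecD[OF a m] distrib_left[symmetric] by simp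
  qed
  finally show ?thesis
    by (simp add: frob_inner_rcirc_rcirc d_def sum_distrib_left)
qed

text \<open>For these geometric vectors the circulant and the reverse circulant coincide, so the residue,
  being orthogonal to circulants, forces the coefficients of its projection to have vanishing
  plain and (for even \<^term>\<open>n\<close>) alternating sums.\<close>

lemma sum_power_b_coeffs:
  fixes s :: real
  assumes n: "n > 0" and s: "s * s = 1" "s ^ n = 1"
  shows "(\<Sum>j<n. s ^ j * b_coeffs n t $ j) = 0"
proof -
  define a where "a = vec n (\<lambda>j. s ^ j)"
  have pmod: "s ^ (i mod n) = s ^ i" for i
  proof -
    have "s ^ i = s ^ (n * (i div n) + i mod n)" by simp
    also have "\<dots> = s ^ (i mod n)" unfolding power_add power_mult s(2) by simp
    finally show ?thesis ..
  qed
  have a: "symmetric_vec n a" unfolding symmetric_vec_def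
  proof (intro conjI allI impI)
    fix j assume j: "j < n"
    \<comment> \<open>Two readings of the same product: \<open>s ^ n = 1\<close> collapses the inner
      factors, \<open>s * s = 1\<close> the two outer ones.\<close>
    have "s ^ j * (s ^ j * s ^ (n - j)) = s ^ j"
      using j s(2) by (simp flip: power_add)
    then have "s ^ j = s ^ (n - j)"
      using s(1) by (simp add: mult.assoc[symmetric] power_mult_distrib[symmetric])
    then show "a $ j = a $ ((n - j) mod n)" using j by (simp add: a_def pmod)
  qed (simp add: a_def)
  have "rcirc n a $$ (k, m) = circ n a $$ (k, m)" if km: "k < n" "m < n" for k m
  proof -
    have "nat \<bar>int k - int m\<bar> < n" using km by auto
    \<comment> \<open>The exponents \<open>k + m\<close> and the distance of \<open>k\<close> and
      \<open>m\<close> differ by an even number, which \<open>s * s = 1\<close> makes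
      invisible.\<close>
    moreover have "s ^ (nat \<bar>int k - int m\<bar> + 2 * min k m) = s ^ (k + m)"
      by (rule arg_cong[where f = "(^) s"]) auto
    ultimately show ?thesis
      using km n s(1) circ_symmetric_entry[OF a km]
      by (simp add: rcirc_def a_def pmod power_add power_mult power2_eq_square)
  qed
  then have "frob_inner n E (rcirc n a) = frob_inner n E (circ n a)" for E
    by (intro frob_inner_cong) auto
  then have "real n * (\<Sum>j<n. b_coeffs n t $ j * a $ j) = 0"
    using frob_inner_defect_rcirc[OF n a] frob_inner_defect_circ[OF n a]
    by (simp add: frob_inner_rcirc_rcirc)
  then show ?thesis using n by (simp add: a_def mult.commute)
qed

text \<open>The choices \<open>s = 1\<close> and, for even \<open>n\<close>, \<open>s = -1\<close>
  give the vanishing plain and alternating sums.\<close>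

lemma rcirc_b_coeffs_mem_B_set:
  assumes n: "n > 0"
  shows "rcirc n (b_coeffs n t) \<in> B_set n"
  using sum_power_b_coeffs[OF n, of 1 t] sum_power_b_coeffs[OF n, of "-1" t]
  by (intro rcirc_mem_B_set[OF n symmetric_b_coeffs]) auto

theorem theorem6p1:
  fixes n :: nat and t :: "nat \<Rightarrow> real"
  assumes "n \<ge> 1"
  shows "\<exists>C \<in> C_set n. \<exists>B \<in> B_set n.
           C = circ n (c_coeffs n t) \<and> B = rcirc n (b_coeffs n t) \<and>
           the_minimizer (\<lambda>G. frobenius_norm (G - sym_toeplitz n t)) (G_hat_set n) (C + B) \<and>
           the_minimizer (\<lambda>G. frobenius_norm (G - sym_toeplitz n t)) (G_set n) (C + B)"
proof -
  have n: "n > 0" using assms by simp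
  define T where "T = sym_toeplitz n t"
  define C where "C = circ n (c_coeffs n t)"
  define B where "B = rcirc n (b_coeffs n t)"
  define E where "E = sym_toeplitz n (toeplitz_defect n t)"
  have CC: "C \<in> C_set n"
    unfolding C_def C_set_eq[OF n] using symmetric_c_coeffs by blast
  have BB: "B \<in> B_set n" unfolding B_def by (rule rcirc_b_coeffs_mem_B_set[OF n])
  have cm: "circ n a \<in> carrier_mat n n" "rcirc n a \<in> carrier_mat n n" "sym_toeplitz n d \<in> carrier_mat n n" for a d
    by (simp_all add: circ_def rcirc_def sym_toeplitz_def)
  have PG: "C + B \<in> G_set n" by (rule C_plus_B_mem_G_set[OF CC BB])
  have sub: "G_set n \<subseteq> G_hat_set n" by (rule G_set_subset_G_hat_set[OF n])
  have hat: "\<exists>a h. symmetric_vec n a \<and> symmetric_vec n h \<and> G = circ n a + rcirc n h" if "G \<in> G_hat_set n" for G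
    using that unfolding G_hat_set_def C_set_eq[OF n] H1_set_def by blast
  have hat_carrier: "G_hat_set n \<subseteq> carrier_mat n n"
    using hat cm by fastforce
  \<comment> \<open>Here \<open>T - C\<close> is the defect matrix \<open>E\<close>, so the residue
    is \<open>E - B\<close>.\<close>
  have res: "frob_inner n (T - (C + B)) X = frob_inner n E X - frob_inner n B X" for X
  proof -
    have "frob_inner n (T - (C + B)) X = frob_inner n (E - B) X"
    proof (rule frob_inner_cong)
      fix i j assume ij: "i < n" "j < n"
      then show "(T - (C + B)) $$ (i, j) = (E - B) $$ (i, j)"
        using sym_toeplitz_minus_circ[OF ij, of t] cm[THEN carrier_matD(1)] cm[THEN carrier_matD(2)]
        by (simp add: T_def C_def B_def E_def)
    qed simp
    then show ?thesis using frob_inner_diff_left[of E n B X] cm by (simp add: E_def B_def)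
  qed
  have orth0: "frob_inner n (T - (C + B)) G = 0" if "G \<in> G_hat_set n" for G
  proof -
    from hat[OF that] obtain a h where ah: "symmetric_vec n a" "symmetric_vec n h"
      and G: "G = circ n a + rcirc n h" by blast
    \<comment> \<open>Against circulants \<open>E\<close> and \<open>B\<close> contribute zero
      separately; against symmetric reverse circulants their contributions are equal and
      cancel.\<close>
    have "circ n a \<in> C_set n" using ah C_set_eq[OF n] by blast
    then have "frob_inner n B (circ n a) = 0" by (rule frob_inner_B_C[OF n BB])
    then have "frob_inner n (T - (C + B)) (circ n a) = 0"
      unfolding res using frob_inner_defect_circ[OF n ah(1)] by (simp add: E_def)
    moreover have "frob_inner n (T - (C + B)) (rcirc n h) = 0"
      unfolding res unfolding E_def B_def using frob_inner_defect_rcirc[OF n ah(2)] by simp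
    ultimately show ?thesis unfolding G using frob_inner_add_right[OF cm(1,2)] by simp
  qed
  have P: "C + B \<in> G_hat_set n" using PG sub by auto
  \<comment> \<open>The residue is orthogonal to \<open>G\<close> and, as \<open>C + B\<close> lies
    in the same set, to \<open>C + B\<close> as well.\<close>
  have orth: "frob_inner n (T - (C + B)) (G - (C + B)) = 0" if "G \<in> G_hat_set n" for G
    using orth0[OF that] orth0[OF P] hat_carrier that P
    by (subst frob_inner_diff_right) auto
  have T: "T \<in> carrier_mat n n" unfolding T_def by (rule cm)
  have "the_minimizer (\<lambda>G. frobenius_norm (G - T)) (G_hat_set n) (C + B)"
    by (rule the_minimizer_orthogonal[OF hat_carrier T P orth])
  moreover have "the_minimizer (\<lambda>G. frobenius_norm (G - T)) (G_set n) (C + B)"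
    by (rule the_minimizer_orthogonal[OF _ T PG orth]) (use sub hat_carrier in auto)
  ultimately show ?thesis
    using CC BB unfolding T_def C_def B_def by blast
qed

end
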